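(* Let $I$ be a finite set of non-negative integers with $0\in I$ and with the greatest common divisor of the elements of $I$ equal to $1$; let $V=\langle x^{i}\mid i\in I\rangle\subset\mathbb{C}[x]$. For $m\in\mathbb{Z}$ put $I^{(m)}=\{i\in I\mid i+m\ge0,\ i+m\notin I\}$. Suppose that there is no integer $l>0$ with $|I^{(l)}|=1$ and that there are at least two distinct integers $l>0$ with $|I^{(l)}|=2$. Then $I$ is of one of the following forms A–D, and in each case the linear differential operators of order at most $2$ with polynomial coefficients that map $V$ into $V$ are exactly the operators $T_2$ listed, with arbitrary coefficients $\alpha_j\in\mathbb{C}$. A. $I=\{0,m,m+l\}$ with integers $m,l\geq 1$, $l\ne m$: $$T_2=\alpha_1x^{l+m}(x\partial-m)(x\partial-l-m)+\alpha_2x^{l+1}\partial(x\partial-l-m)+\alpha_3x^m(x\partial-m)(x\partial-l-m)+\alpha_4x^2\partial^2+\alpha_5x\partial+\alpha_6,$$ plus the following extra terms (and none otherwise): (a) if $m=1$ and $l>2$: $\alpha_7\partial(x\partial-l-m)$; (b) if $m=1$ and $l=2$: $\alpha_7\partial(x\partial-3)+\alpha_8\partial^2$; (c) if $l=1$ (hence $m>1$): $\alpha_7\partial(x\partial-m)$. B. $I=\{0,m,m+l,2m+l\}$ with integers $m,l\geq 1$, $l\neq m$: $$T_2=\alpha_1x^{l+m}(x\partial-2m-l)(x\partial-l-m)+\alpha_2x^m(x\partial-2m-l)(x\partial-m)+\alpha_3x^2\partial^2+\alpha_4x\partial+\alpha_5,$$ plus the extra term $\alpha_6\partial(x\partial-m-l)$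 if $m=1$ (and no extra term otherwise). C. $I=\{0,1,2,\dots,n-2,n\}$ with $n\ge4$: $$T_2=\alpha_1x^2(x\partial-n)(x\partial-n+3)+\alpha_2x(x\partial-n)(x\partial-n+2)+\alpha_3x^2\partial^2+\alpha_4x\partial+\alpha_5+\alpha_6\partial(x\partial-n)+\alpha_7\partial^2.$$ D. $I=\{0,2,3,4,\dots,n\}$ with $n\ge4$: $$T_2=\alpha_1x^2(x\partial-n)(x\partial-n+1)+\alpha_2x^2\partial(x\partial-n)+\alpha_3x^2\partial^2+\alpha_4x\partial+\alpha_5+\alpha_6\partial(x\partial-2).$$
   Context: $\partial=d/dx$, and $\langle\cdot\rangle$ denotes complex linear span. Differential operators are of the form $\sum_iP_i\partial^i$ with $P_i\in\mathbb{C}[x]$, acting on $\mathbb{C}[x]$. *)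

theory Defs
  imports "HOL-Computational_Algebra.Polynomial" Complex_Main
begin

lemma vector_space_smult:
  "vector_space (smult :: complex \<Rightarrow> complex poly \<Rightarrow> complex poly)"
  by unfold_locales (simp_all add: smult_add_right smult_add_left)

definition monomial_span :: "nat set \<Rightarrow> complex poly set" where
  "monomial_span I = module.span smult ((\<lambda>i. monom 1 i) ` I)"

text \<open>The set \<open>I\<^sup>(\<^sup>m\<^sup>)\<close> of the exponents in \<open>I\<close> that a shift by \<open>m\<close> moves out of \<open>I\<close>
  without making them negative.\<close>

definition shift_out :: "nat set \<Rightarrow> int \<Rightarrow> nat set" where
  "shift_out I m = {i \<in> I. int i + m \<ge> 0 \<and> int i + m \<notin> int ` I}"

text \<open>Differential operators are identified with the maps on polynomials that they induce;
  in characteristic 0 the coefficients are determined by the map.\<close>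

definition diff_op :: "nat \<Rightarrow> (nat \<Rightarrow> complex poly) \<Rightarrow> complex poly \<Rightarrow> complex poly" where
  "diff_op k P = (\<lambda>f. \<Sum>i\<le>k. P i * (pderiv ^^ i) f)"

definition diff_ops_le :: "nat \<Rightarrow> (complex poly \<Rightarrow> complex poly) set" where
  "diff_ops_le k = range (diff_op k)"

definition preserving_ops :: "nat \<Rightarrow> complex poly set \<Rightarrow> (complex poly \<Rightarrow> complex poly) set" where
  "preserving_ops k V = {T \<in> diff_ops_le k. T ` V \<subseteq> V}"

text \<open>Multiplication by \<open>x\<^sup>k\<close>, and the operator \<open>x\<partial> - c\<close>.\<close>

definition xpow :: "nat \<Rightarrow> complex poly \<Rightarrow> complex poly" where
  "xpow k f = monom 1 k * f"

definition xD_minus :: "complex \<Rightarrow> complex poly \<Rightarrow> complex poly" where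
  "xD_minus c f = xpow 1 (pderiv f) - smult c f"

text \<open>In the following families products of operators are compositions, so that for example
  \<open>x\<^sup>k \<partial> (x\<partial> - c)\<close> is \<open>\<lambda>f. xpow k (pderiv (xD_minus c f))\<close>.
  Only finitely many of the values \<open>\<alpha> j\<close> are used.\<close>

definition T2_A_extra :: "nat \<Rightarrow> nat \<Rightarrow> (nat \<Rightarrow> complex) \<Rightarrow> complex poly \<Rightarrow> complex poly" where
  "T2_A_extra m l \<alpha> f =
    (if m = 1 \<and> l > 2 then smult (\<alpha> 7) (pderiv (xD_minus (of_nat (l + m)) f))
     else if m = 1 \<and> l = 2 then
       smult (\<alpha> 7) (pderiv (xD_minus 3 f)) + smult (\<alpha> 8) (pderiv (pderiv f))
     else if m > 1 \<and> l = 1 then smult (\<alpha> 7) (pderiv (xD_minus (of_nat m) f))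
     else 0)"

definition T2_A :: "nat \<Rightarrow> nat \<Rightarrow> (nat \<Rightarrow> complex) \<Rightarrow> complex poly \<Rightarrow> complex poly" where
  "T2_A m l \<alpha> = (\<lambda>f.
      smult (\<alpha> 1) (xpow (l + m) (xD_minus (of_nat m) (xD_minus (of_nat (l + m)) f)))
    + smult (\<alpha> 2) (xpow (l + 1) (pderiv (xD_minus (of_nat (l + m)) f)))
    + smult (\<alpha> 3) (xpow m (xD_minus (of_nat m) (xD_minus (of_nat (l + m)) f)))
    + smult (\<alpha> 4) (xpow 2 (pderiv (pderiv f)))
    + smult (\<alpha> 5) (xpow 1 (pderiv f))
    + smult (\<alpha> 6) f
    + T2_A_extra m l \<alpha> f)"

definition T2_B :: "nat \<Rightarrow> nat \<Rightarrow> (nat \<Rightarrow> complex) \<Rightarrow> complex poly \<Rightarrow> complex poly" where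
  "T2_B m l \<alpha> = (\<lambda>f.
      smult (\<alpha> 1) (xpow (l + m) (xD_minus (of_nat (2 * m + l)) (xD_minus (of_nat (l + m)) f)))
    + smult (\<alpha> 2) (xpow m (xD_minus (of_nat (2 * m + l)) (xD_minus (of_nat m) f)))
    + smult (\<alpha> 3) (xpow 2 (pderiv (pderiv f)))
    + smult (\<alpha> 4) (xpow 1 (pderiv f))
    + smult (\<alpha> 5) f
    + (if m = 1 then smult (\<alpha> 6) (pderiv (xD_minus (of_nat (m + l)) f)) else 0))"

definition T2_C :: "nat \<Rightarrow> (nat \<Rightarrow> complex) \<Rightarrow> complex poly \<Rightarrow> complex poly" where
  "T2_C n \<alpha> = (\<lambda>f.
      smult (\<alpha> 1) (xpow 2 (xD_minus (of_nat n) (xD_minus (of_nat n - 3) f)))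
    + smult (\<alpha> 2) (xpow 1 (xD_minus (of_nat n) (xD_minus (of_nat n - 2) f)))
    + smult (\<alpha> 3) (xpow 2 (pderiv (pderiv f)))
    + smult (\<alpha> 4) (xpow 1 (pderiv f))
    + smult (\<alpha> 5) f
    + smult (\<alpha> 6) (pderiv (xD_minus (of_nat n) f))
    + smult (\<alpha> 7) (pderiv (pderiv f)))"

definition T2_D :: "nat \<Rightarrow> (nat \<Rightarrow> complex) \<Rightarrow> complex poly \<Rightarrow> complex poly" where
  "T2_D n \<alpha> = (\<lambda>f.
      smult (\<alpha> 1) (xpow 2 (xD_minus (of_nat n) (xD_minus (of_nat n - 1) f)))
    + smult (\<alpha> 2) (xpow 2 (pderiv (xD_minus (of_nat n) f)))
    + smult (\<alpha> 3) (xpow 2 (pderiv (pderiv f)))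
    + smult (\<alpha> 4) (xpow 1 (pderiv f))
    + smult (\<alpha> 5) f
    + smult (\<alpha> 6) (pderiv (xD_minus 2 f)))"

definition form_A :: "nat set \<Rightarrow> nat \<Rightarrow> nat \<Rightarrow> bool" where
  "form_A I m l \<longleftrightarrow> m \<ge> 1 \<and> l \<ge> 1 \<and> l \<noteq> m \<and> I = {0, m, m + l}"

definition form_B :: "nat set \<Rightarrow> nat \<Rightarrow> nat \<Rightarrow> bool" where
  "form_B I m l \<longleftrightarrow> m \<ge> 1 \<and> l \<ge> 1 \<and> l \<noteq> m \<and> I = {0, m, m + l, 2 * m + l}"

definition form_C :: "nat set \<Rightarrow> nat \<Rightarrow> bool" where
  "form_C I n \<longleftrightarrow> n \<ge> 4 \<and> I = {0..n - 2} \<union> {n}"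

definition form_D :: "nat set \<Rightarrow> nat \<Rightarrow> bool" where
  "form_D I n \<longleftrightarrow> n \<ge> 4 \<and> I = {0} \<union> {2..n}"

end

theory Submission
  imports Defs
begin

text \<open>If \<open>|I\<^sup>(\<^sup>a\<^sup>)| = 2\<close>, then \<open>I\<close> is a union of two arithmetic progressions of step \<open>a\<close>.
  Two such steps \<open>a < b\<close> leave little room: \<open>I\<close> meets exactly two residue classes modulo \<open>b\<close>,
  and \<open>x, x + a, x + 2a\<close> are pairwise incongruent modulo \<open>b\<close> unless \<open>b = 2a\<close>; hence either both
  progressions of step \<open>a\<close> have at most two terms (forms A and B), or \<open>b = 2a\<close>, which forces \<open>a = 1\<close> and the
  forms C and D unless \<open>|I| = 3\<close>.

  An operator of order at most 2 is a sum of homogeneous components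
  \<open>x\<^sup>n \<mapsto> q\<^sub>k(n) x\<^sup>n\<^sup>+\<^sup>k\<close> with \<open>q\<^sub>k\<close> of degree at most 2. It preserves \<open>V\<close> iff \<open>q\<^sub>k\<close> vanishes on
  \<open>I\<^sup>(\<^sup>k\<^sup>)\<close>, and \<open>q\<^sub>k\<close> vanishes on every \<open>n < -k\<close> because the coefficients are polynomials. So
  \<open>q\<^sub>k = 0\<close> as soon as three zeros are forced, and \<open>q\<^sub>k\<close> is determined up to a scalar by two.\<close>

section \<open>The classification of the exponent sets\<close>

lemma shift_out_of_nat: "shift_out I (int l) = {i \<in> I. i + l \<notin> I}"
  unfolding shift_out_def
  by (auto simp flip: of_nat_add)

text \<open>The induction finds the last point of the chain in \<open>I\<close> before a missing
  one. The bound \<open>j < k\<close> puts this exit strictly below the missing point, which later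
  keeps two exits in the same residue class apart.\<close>

lemma chain_exit:
  assumes "y \<in> I" "y + k * l \<notin> I"
  shows "\<exists>j<k. y + j * l \<in> shift_out I (int l)"
  using assms(2)
proof (induction k)
  case 0
  then show ?case using assms(1) by simp
next
  case (Suc k)
  show ?case
  proof (cases "y + k * l \<in> I")
    case True
    then have "y + k * l \<in> shift_out I (int l)"
      using Suc.prems by (simp add: shift_out_of_nat algebra_simps)
    then show ?thesis by blast
  next
    case False
    then show ?thesis using Suc.IH less_Suc_eq by blast
  qed
qed

text \<open>A finite set is left by every chain, so each residue class modulo \<open>l\<close> that
  meets \<open>I\<close> contributes an element of \<open>shift_out\<close>.\<close>

lemma chain_exit_finite:
  assumes "finite I" "0 < l" "y \<in> I"
  shows "\<exists>j. y + j * l \<in> shift_out I (int l)"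
proof -
  \<comment> \<open>\<open>Suc (Max I)\<close> steps of positive length overshoot the
    maximum.\<close>
  have "Suc (Max I) \<le> Suc (Max I) * l"
    using assms(2) by (metis Suc_leI mult.right_neutral mult_le_mono2 One_nat_def)
  then have "Max I < y + Suc (Max I) * l"
    by linarith
  then have "y + Suc (Max I) * l \<notin> I"
    using assms(1) Max_ge leD by blast
  then show ?thesis using chain_exit[OF assms(3)] by blast
qed

lemma card_eq_2_cases:
  assumes "card S = 2" "x \<in> S" "y \<in> S" "z \<in> S"
  shows "x = y \<or> x = z \<or> y = z"
  using assms by (auto simp: card_2_iff)

text \<open>An exit keeps the residue of the start of its chain, so three distinct classes would
  give three exits.\<close>

lemma two_chains_residues:
  assumes "finite I" "0 < l" "card (shift_out I (int l)) = 2" "x \<in> I" "y \<in> I" "z \<in> I"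
  shows "x mod l = y mod l \<or> x mod l = z mod l \<or> y mod l = z mod l"
proof -
  obtain i j k where "x + i * l \<in> shift_out I (int l)" "y + j * l \<in> shift_out I (int l)"
    "z + k * l \<in> shift_out I (int l)"
    using chain_exit_finite assms by metis
  then have "x + i * l = y + j * l \<or> x + i * l = z + k * l \<or> y + j * l = z + k * l"
    using card_eq_2_cases[OF assms(3)] by blast
  then show ?thesis by (metis mod_mult_self1)
qed

text \<open>If \<open>z\<close> were missing from its residue class, that class would contribute two chains and
  the class of \<open>x\<close> a third one.\<close>

lemma two_chains_contiguous:
  assumes "finite I" "0 < l" "card (shift_out I (int l)) = 2"
    and "x \<in> I" "y \<in> I" "v \<in> I" and "x mod l \<noteq> y mod l"
    and "y \<le> z" "z \<le> v" "z mod l = y mod l" "v mod l = y mod l"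
  shows "z \<in> I"
proof (rule ccontr)
  assume z: "z \<notin> I"
  obtain k where k: "z = y + k * l"
    using assms(8,10) by (metis mod_eq_nat2E mult.commute)
  then obtain j where j: "j < k" "y + j * l \<in> shift_out I (int l)"
    using chain_exit assms(5) z by blast
  obtain i i' where i: "x + i * l \<in> shift_out I (int l)" "v + i' * l \<in> shift_out I (int l)"
    using chain_exit_finite assms by metis
  have "y + j * l < z" using j(1) k assms(2) by simp
  then have "y + j * l \<noteq> v + i' * l" using assms(9) by simp
  moreover have "x + i * l \<noteq> y + j * l" "x + i * l \<noteq> v + i' * l"
    using assms(7,11) by (metis mod_mult_self1)+
  ultimately show False
    using card_eq_2_cases[OF assms(3) j(2) i] by simp
qed

text \<open>Gaps at \<open>w\<close> and \<open>z\<close> would produce three exits for step 1: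
  below \<open>w\<close>, between \<open>y\<close> and \<open>z\<close>, and from \<open>v\<close>
  upward.\<close>

lemma two_intervals:
  assumes "finite I" "card (shift_out I 1) = 2" "x \<in> I" "y \<in> I" "v \<in> I"
    and "x < w" "w < y" "y < z" "z < v" "w \<notin> I"
  shows "z \<in> I"
proof (rule ccontr)
  assume z: "z \<notin> I"
  have *: "\<exists>j. s \<le> j \<and> j < t \<and> j \<in> shift_out I 1" if st: "s \<in> I" "t \<notin> I" "s < t" for s t
  proof -
    obtain j where "j < t - s" "s + j * 1 \<in> shift_out I (int 1)"
      using chain_exit[of s I "t - s" 1] st by auto
    then show ?thesis using st by (intro exI[of _ "s + j"]) auto
  qed
  obtain i where i: "i < w" "i \<in> shift_out I 1" using *[of x w] assms by blast
  obtain j where j: "y \<le> j" "j < z" "j \<in> shift_out I 1" using *[of y z] assms z by blast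
  obtain k where k: "v + k \<in> shift_out I 1"
    using chain_exit_finite[of I 1 v] assms by auto
  show False
    using card_eq_2_cases[OF assms(2) i(2) j(3) k] i j assms by linarith
qed

section \<open>Sets with two admissible steps\<close>

lemma exists_not_dvd:
  assumes "Gcd I = (1::nat)" "1 < l"
  shows "\<exists>q\<in>I. q mod l \<noteq> 0"
proof (rule ccontr)
  assume "\<not> ?thesis"
  then have "l dvd Gcd I" by (intro Gcd_greatest) auto
  then show False using assms by simp
qed

text \<open>Step 1 makes \<open>I\<close> the union of \<open>{..<g}\<close> and
  \<open>{p..M}\<close>, and the other step decides between the forms: \<open>b = 2\<close> forces a
  gap of one point and an interval of one point (C, D), while \<open>b \<ge> 3\<close> forbids three
  consecutive elements (B with \<open>m = 1\<close>).\<close>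

lemma two_chains_step_1:
  assumes "finite I" "0 \<in> I" "Gcd I = 1" "4 \<le> card I" "1 < b"
    and one: "card (shift_out I 1) = 2" and b2: "card (shift_out I (int b)) = 2"
  shows "(\<exists>m l. form_B I m l) \<or> (\<exists>n. form_C I n) \<or> (\<exists>n. form_D I n)"
proof -
  obtain q where q: "q \<in> I" "q mod b \<noteq> 0"
    using exists_not_dvd[OF assms(3,5)] by blast
  define M where "M = Max I"
  have M: "M \<in> I" "\<And>i. i \<in> I \<Longrightarrow> i \<le> M"
    unfolding M_def using assms(1,2) Max_in Max_ge by blast+
  define g where "g = (LEAST w. w \<notin> I)"
  have g: "g \<notin> I" "\<And>w. w < g \<Longrightarrow> w \<in> I"
    unfolding g_def using LeastI_ex[of "\<lambda>w. w \<notin> I"] ex_new_if_finite[OF _ assms(1)] not_less_Least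
    by (simp, blast)
  have "g > 0" using g(1) assms(2) by (cases g) auto
  \<comment> \<open>Without a gap below the maximum, \<open>M\<close> would be the only exit for
    step 1.\<close>
  have "g < M"
  proof (rule ccontr)
    assume "\<not> g < M"
    then have "M < g" using g(1) M(1) by (cases "g = M") auto
    then have "I = {..M}" using g(2) M(2) by force
    then have "shift_out I (int 1) = {M}"
      unfolding shift_out_of_nat by auto
    then show False using one by simp
  qed
  define p where "p = (LEAST x. x \<in> I \<and> g < x)"
  have p: "p \<in> I" "g < p" "\<And>x. x \<in> I \<Longrightarrow> g < x \<Longrightarrow> p \<le> x"
    unfolding p_def using LeastI[of "\<lambda>x. x \<in> I \<and> g < x" M] M(1) \<open>g < M\<close>
    by (simp_all add: Least_le)
  have pM: "p \<le> M" using p M by blast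
  \<comment> \<open>There is already a gap at \<open>g\<close>, between \<open>g - 1\<close> and
    \<open>p\<close>, so a second one above \<open>p\<close> is excluded.\<close>
  have up: "z \<in> I" if "p \<le> z" "z \<le> M" for z
  proof (cases "z = p \<or> z = M")
    case True
    then show ?thesis using p M by blast
  next
    case False
    then show ?thesis
      using two_intervals[OF assms(1) one g(2)[of "g - 1"] p(1) M(1), of g z] g(1) p(2) \<open>g > 0\<close> that
      by simp
  qed
  have I: "I = {..<g} \<union> {p..M}"
  proof (intro equalityI subsetI)
    fix x assume "x \<in> I"
    then show "x \<in> {..<g} \<union> {p..M}"
      using g(1) p(3) M(2) by (cases x g rule: linorder_cases) auto
  next
    fix x assume "x \<in> {..<g} \<union> {p..M}"
    then show "x \<in> I" using g(2) up by auto
  qed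
  have card: "card I = g + (Suc M - p)"
    unfolding I using p(2) by (subst card_Un_disjoint) auto
  show ?thesis
  proof (cases "b = 2")
    case True
    have odd: "q mod 2 \<noteq> 0 mod 2" using q True by simp
    \<comment> \<open>\<open>q\<close> is odd and 0 is even, so contiguity is available in both
      parity classes.\<close>
    have "\<exists>x\<in>I. x mod 2 \<noteq> y mod 2" for y :: nat
      using odd q(1) assms(2) by (metis)
    then have cont: "z \<in> I" if "y \<in> I" "v \<in> I" "y \<le> z" "z \<le> v" "z mod 2 = y mod 2" "v mod 2 = y mod 2"
      for y z v
      using two_chains_contiguous[OF assms(1) _ b2] that True by (metis zero_less_numeral)
    have parity: "x mod 2 = y mod 2 \<or> x mod 2 = (y + 1) mod 2" for x y :: nat
      by presburger
    have pg: "p = g + 1"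
    proof (rule ccontr)
      assume "p \<noteq> g + 1"
      then have gap: "g + 1 \<notin> I" using p by force
      \<comment> \<open>One of the missing points \<open>g\<close> and \<open>g + 1\<close> has the
        parity of \<open>y\<close>, so no parity occurs on both sides of the gap.\<close>
      have no: False if "y \<in> I" "v \<in> I" "y < g" "g + 1 < v" "v mod 2 = y mod 2" for y v
      proof (cases "g mod 2 = y mod 2")
        case True
        then show False using cont[of y v g] that g(1) by auto
      next
        case False
        then have "(g + 1) mod 2 = y mod 2" by presburger
        then show False using cont[of y v "g + 1"] that gap by auto
      qed
      \<comment> \<open>One side contains two neighbours, hence both parities, and therefore shares
        a parity with the other side.\<close>
      have "g \<ge> 2 \<or> M \<ge> p + 1" using card assms(4) by linarith
      then show False
      proof
        assume "g \<ge> 2"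
        then have "g - 2 + 1 = g - 1" by simp
        then have "p mod 2 = (g - 2) mod 2 \<or> p mod 2 = (g - 1) mod 2"
          using parity[of p "g - 2"] by metis
        moreover have "g - 1 \<in> I" "g - 2 \<in> I" "g - 1 < g" "g - 2 < g" "g + 1 < p"
          using g(2) \<open>g > 0\<close> p(2) \<open>p \<noteq> g + 1\<close> by auto
        ultimately show False
          using no[of "g - 1" p] no[of "g - 2" p] p(1) by blast
      next
        assume "M \<ge> p + 1"
        have "p mod 2 = (g - 1) mod 2 \<or> (p + 1) mod 2 = (g - 1) mod 2"
          using parity[of "g - 1" p] by metis
        moreover have "g - 1 \<in> I" "p + 1 \<in> I" "g - 1 < g" "g + 1 < p" "g + 1 < p + 1"
          using g(2) \<open>g > 0\<close> p(2) \<open>p \<noteq> g + 1\<close> \<open>M \<ge> p + 1\<close> up by auto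
        ultimately show False
          using no[of "g - 1" p] no[of "g - 1" "p + 1"] p(1) by blast
      qed
    qed
    consider "g = 1" | "M = p" | "g \<ge> 2" "M \<ge> p + 1"
      using \<open>g > 0\<close> pM by linarith
    then show ?thesis
    proof cases
      case 1
      then have "form_D I M"
        unfolding form_D_def using I pg card assms(4) by auto
      then show ?thesis by blast
    next
      case 2
      then have "form_C I M"
        unfolding form_C_def using I pg card assms(4) \<open>g > 0\<close> by auto
      then show ?thesis by blast
    next
      case 3
      \<comment> \<open>\<open>g - 2\<close> and \<open>g + 2\<close> lie in \<open>I\<close> and
        have the parity of \<open>g\<close>, so contiguity would put \<open>g\<close> into
        \<open>I\<close>.\<close>
      have "(g - 2) mod 2 = g mod 2" "(g + 2) mod 2 = (g - 2) mod 2"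
        using 3(1) by (simp_all add: le_mod_geq)
      then show ?thesis
        using cont[of "g - 2" "g + 2" g] g 3 up[of "g + 2"] pg by auto
    qed
  next
    case False
    then have "b \<ge> 3" using assms(5) by simp
    have no3: False if "x \<in> I" "x + 1 \<in> I" "x + 2 \<in> I" for x
    proof -
      have d: "\<not> b dvd 1" "\<not> b dvd 2" using \<open>b \<ge> 3\<close> by (auto dest: dvd_imp_le)
      have "x mod b \<noteq> (x + 1) mod b" "x mod b \<noteq> (x + 2) mod b" "(x + 1) mod b \<noteq> (x + 2) mod b"
        using d mod_eq_dvd_iff_nat[of x "x + 1" b] mod_eq_dvd_iff_nat[of x "x + 2" b]
          mod_eq_dvd_iff_nat[of "x + 1" "x + 2" b] by auto
      then show False
        using two_chains_residues[OF assms(1) _ b2 that] assms(5) by auto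
    qed
    have "g \<le> 2"
      using no3[of 0, OF g(2) g(2) g(2)] by (cases "2 < g") auto
    moreover have "M \<le> p + 1"
      using no3[of p, OF up up up] by (cases "p + 2 \<le> M") auto
    \<comment> \<open>Each interval has at most two points and together they have at least
      four.\<close>
    ultimately have gM: "g = 2" "M = p + 1" using card assms(4) by linarith+
    then have "I = {0, 1, p, p + 1}" using I by auto
    then have "form_B I 1 (p - 1)"
      unfolding form_B_def using p(2) gM by auto
    then show ?thesis by blast
  qed
qed

text \<open>\<open>p\<close> opens the class modulo \<open>a\<close> that does not contain 0, and
  both classes are contiguous. If \<open>b = 2 * a\<close>, neither \<open>a\<close> nor
  \<open>p + a\<close> can lie in \<open>I\<close>, which leaves too few elements. Otherwise each
  class has at most two terms, and four elements force \<open>{0, a, p, p + a}\<close>.\<close>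

lemma two_chains_step_ge_2:
  assumes "finite I" "0 \<in> I" "Gcd I = 1" "4 \<le> card I" "1 < a" "a < b"
    and a2: "card (shift_out I (int a)) = 2" and b2: "card (shift_out I (int b)) = 2"
  shows "\<exists>m l. form_B I m l"
proof -
  define p where "p = (LEAST x. x \<in> I \<and> x mod a \<noteq> 0)"
  have "\<exists>x. x \<in> I \<and> x mod a \<noteq> 0"
    using exists_not_dvd[OF assms(3,5)] by blast
  then have p: "p \<in> I" "p mod a \<noteq> 0" "\<And>x. x \<in> I \<Longrightarrow> x mod a \<noteq> 0 \<Longrightarrow> p \<le> x"
    unfolding p_def by (metis (mono_tags, lifting) LeastI_ex, metis (mono_tags, lifting) LeastI_ex, simp add: Least_le)
  have a0: "0 < a" "0 < b" using assms by auto
  have res: "z mod a = 0 \<or> z mod a = p mod a" if "z \<in> I" for z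
    using two_chains_residues[OF assms(1) a0(1) a2 assms(2) p(1) that] p(2) by auto
  have cont0: "k * a \<in> I" if "z \<in> I" "z mod a = 0" "k * a \<le> z" for z k
    using two_chains_contiguous[OF assms(1) a0(1) a2 p(1) assms(2), of z "k * a"] that p(2) by auto
  have contp: "p + k * a \<in> I" if "z \<in> I" "z mod a = p mod a" "p + k * a \<le> z" for z k
    using two_chains_contiguous[OF assms(1) a0(1) a2 assms(2) p(1), of z "p + k * a"] that p(2) by auto
  show ?thesis
  proof (cases "b = 2 * a")
    case True
    have resb: "z mod b = 0 \<or> z mod b = p mod b" if "z \<in> I" for z
    proof -
      have "p mod b \<noteq> 0" using p(2) True by (metis mod_mod_cancel dvd_triv_right mod_0)
      then show ?thesis
        using two_chains_residues[OF assms(1) a0(2) b2 assms(2) p(1) that] by auto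
    qed
    have ba: "a dvd b" using True by simp
    have "z = 0 \<or> z = p" if "z \<in> I" for z
      using res[OF that]
    proof
      assume z: "z mod a = 0"
      \<comment> \<open>As \<open>a\<close> is nonzero modulo \<open>b\<close>, it would be
        congruent to \<open>p\<close> modulo \<open>b\<close>, hence modulo \<open>a\<close>, making
        \<open>p\<close> divisible by \<open>a\<close>.\<close>
      have "a \<notin> I"
      proof
        assume "a \<in> I"
        then have "a mod b = p mod b" using resb[of a] assms by auto
        then have "a mod a = p mod a" using ba by (metis mod_mod_cancel)
        then show False using p(2) by simp
      qed
      then show ?thesis using cont0[OF that z, of 1] z by (auto dest: dvd_imp_le)
    next
      assume z: "z mod a = p mod a"
      then have "p \<le> z" using p that by auto
      \<comment> \<open>Residue 0 modulo \<open>b\<close> would make \<open>p\<close> divisible by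
        \<open>a\<close>; the residue of \<open>p\<close> would make \<open>a\<close> divisible by
        the larger \<open>b\<close>.\<close>
      have "p + a \<notin> I"
      proof
        assume "p + a \<in> I"
        from resb[OF this] show False
        proof
          assume "(p + a) mod b = 0"
          then have "b dvd p + a" by (simp add: dvd_eq_mod_eq_0)
          then have "a dvd p + a" using ba dvd_trans by blast
          then show False using p(2) by (simp add: dvd_eq_mod_eq_0)
        next
          assume "(p + a) mod b = p mod b"
          then have "b dvd p + a - p" by (subst (asm) mod_eq_dvd_iff_nat) auto
          then have "b dvd a" by simp
          then show False using assms(5,6) dvd_imp_le[of b a] by linarith
        qed
      qed
      then have "z < p + a" using contp[OF that z, of 1] by (auto simp: not_le[symmetric])
      moreover have "a dvd z - p" using z \<open>p \<le> z\<close> by (metis mod_eq_dvd_iff_nat)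
      ultimately show ?thesis using \<open>p \<le> z\<close> by (auto dest: dvd_imp_le)
    qed
    then have "I \<subseteq> {0, p}" by auto
    then have "card I \<le> card {0, p}" by (intro card_mono) auto
    then show ?thesis using assms(4) card_insert_le_m1[of 2 "{p}" 0] by (auto simp: card_insert_if split: if_splits)
  next
    case False
    have no3: False if "x \<in> I" "x + a \<in> I" "x + 2 * a \<in> I" for x
    proof -
      have "\<not> b dvd a" using assms by (auto dest: dvd_imp_le)
      \<comment> \<open>\<open>2 * a\<close> is positive, below \<open>2 * b\<close> and different
        from \<open>b\<close>.\<close>
      moreover have "\<not> b dvd 2 * a"
      proof
        assume "b dvd 2 * a"
        then obtain c where c: "2 * a = b * c" by blast
        have "b * c < b * 2" using c assms(6) by linarith
        then have "c = 0 \<or> c = 1" by auto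
        then show False using c False a0 by auto
      qed
      ultimately have "x mod b \<noteq> (x + a) mod b" "x mod b \<noteq> (x + 2 * a) mod b"
          "(x + a) mod b \<noteq> (x + 2 * a) mod b"
        using mod_eq_dvd_iff_nat[of x "x + a" b] mod_eq_dvd_iff_nat[of x "x + 2 * a" b]
          mod_eq_dvd_iff_nat[of "x + a" "x + 2 * a" b] by auto
      then show False
        using two_chains_residues[OF assms(1) a0(2) b2 that] by auto
    qed
    have "z \<in> {0, a, p, p + a}" if "z \<in> I" for z
      using res[OF that]
    proof
      assume z: "z mod a = 0"
      then obtain k where k: "z = a * k" by blast
      have "\<not> 2 * a \<le> z"
        using no3[of 0] cont0[OF that z, of 1] cont0[OF that z, of 2] assms(2) by auto
      then have "k < 2" using k by (metis mult.commute not_less mult_le_mono2)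
      then show ?thesis using k by (cases "k = 0") auto
    next
      assume z: "z mod a = p mod a"
      then have "p \<le> z" using p that by auto
      then obtain k where k: "z = p + a * k" using z by (metis mod_eq_nat2E)
      have "\<not> p + 2 * a \<le> z"
        using no3[of p] contp[OF that z, of 1] contp[OF that z, of 2] p(1) by auto
      then have "k < 2" using k by (metis mult.commute not_less mult_le_mono2 add_le_mono le_refl)
      then show ?thesis using k by (cases "k = 0") auto
    qed
    then have sub: "I \<subseteq> {0, a, p, p + a}" by blast
    have "card {0, a, p, p + a} \<le> card I"
      using assms(4) card_length[of "[0, a, p, p + a]"] by simp
    then have I: "I = {0, a, p, p + a}"
      using sub card_seteq[of "{0, a, p, p + a}" I] by auto
    have "p \<noteq> a" "p \<noteq> 2 * a" "0 < p" using p(2) by (auto intro: gr0I)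
    \<comment> \<open>This secures \<open>l \<noteq> m\<close> in the form B: for
      \<open>a = 2 * p\<close> the elements 0, \<open>p\<close>, \<open>a\<close> are distinct and
      below \<open>b\<close>, so they have three residues.\<close>
    have "a \<noteq> 2 * p"
    proof
      assume ap: "a = 2 * p"
      then have "0 mod b = p mod b \<or> 0 mod b = a mod b \<or> p mod b = a mod b"
        using two_chains_residues[OF assms(1) a0(2) b2, of 0 p a] I by auto
      moreover have "p < b" using ap assms by simp
      ultimately show False using ap assms(6) \<open>0 < p\<close> by auto
    qed
    show ?thesis
    \<comment> \<open>The smaller of \<open>a\<close> and \<open>p\<close> becomes \<open>m\<close>,
      their difference \<open>l\<close>.\<close>
    proof (cases "a < p")
      case True
      then have "form_B I a (p - a)"
        unfolding form_B_def using I \<open>p \<noteq> 2 * a\<close> assms(5) by auto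
      then show ?thesis by blast
    next
      case False
      then have "form_B I p (a - p)"
        unfolding form_B_def using I \<open>a \<noteq> 2 * p\<close> \<open>p \<noteq> a\<close> \<open>0 < p\<close> by auto
      then show ?thesis by blast
    qed
  qed
qed

text \<open>The only obstruction is \<open>l = m\<close>, and a progression
  \<open>{0, x, 2 * x}\<close> has a single exit for step \<open>x\<close>.\<close>

lemma card_eq_3_form_A:
  assumes "card I = 3" "(0::nat) \<in> I" "\<And>l::int. l > 0 \<Longrightarrow> card (shift_out I l) \<noteq> 1"
  shows "\<exists>m l. form_A I m l"
proof -
  have fin: "finite I" using assms(1) by (metis card.infinite zero_neq_numeral)
  then have "card (I - {0}) = 2" using assms by simp
  then obtain x y where xy: "I - {0} = {x, y}" "x < y"
    by (metis card_2_iff insert_commute linorder_neqE_nat)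
  have I: "I = {0, x, y}"
    using insert_Diff[OF assms(2)] unfolding xy(1) by simp
  have "x \<in> I - {0}" unfolding xy(1) by simp
  then have "0 < x" by simp
  have "y - x \<noteq> x"
  proof
    assume "y - x = x"
    then have "y = 2 * x" using xy(2) by simp
    then have "shift_out I (int x) = {2 * x}"
      unfolding shift_out_of_nat I using \<open>0 < x\<close> by auto
    then show False using assms(3)[of "int x"] \<open>0 < x\<close> by simp
  qed
  then have "form_A I x (y - x)"
    unfolding form_A_def using I xy(2) \<open>0 < x\<close> by auto
  then show ?thesis by blast
qed

text \<open>Among the smaller sets \<open>{0}\<close> has gcd 0, and gcd 1 leaves
  \<open>{0, 1}\<close>, which has the single exit 1 for step 1.\<close>

lemma card_ge_3:
  assumes "finite I" "(0::nat) \<in> I" "Gcd I = 1" "card (shift_out I 1) \<noteq> 1"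
  shows "3 \<le> card I"
proof (rule ccontr)
  assume "\<not> ?thesis"
  then have "card (I - {0}) \<le> 1" using assms by simp
  then have "I - {0} = {} \<or> (\<exists>x. I - {0} = {x})"
    using assms(1) by (metis card_0_eq card_1_singletonE finite_Diff le_less less_one)
  then consider "I = {0}" | x where "I = {0, x}" "0 < x"
    using assms(2) by (metis insert_Diff insertI1 DiffE singletonI gr0I)
  then show False
  proof cases
    case 1
    then show False using assms(3) by simp
  next
    case 2
    then have "I = {0, 1}" using assms(3) by simp
    then have "shift_out I (int 1) = {1}" unfolding shift_out_of_nat by auto
    then show False using assms(4) by simp
  qed
qed

lemma classification:
  assumes "finite I" "0 \<in> I" "Gcd I = 1"
    and no1: "\<And>l::int. l > 0 \<Longrightarrow> card (shift_out I l) \<noteq> 1"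
    and "0 < a" "a < b" "card (shift_out I (int a)) = 2" "card (shift_out I (int b)) = 2"
  shows "(\<exists>m l. form_A I m l) \<or> (\<exists>m l. form_B I m l) \<or> (\<exists>n. form_C I n) \<or> (\<exists>n. form_D I n)"
proof (cases "card I = 3")
  case True
  then show ?thesis using card_eq_3_form_A assms by blast
next
  case False
  then have c4: "4 \<le> card I" using card_ge_3[OF assms(1-3)] no1[of 1] by force
  show ?thesis
  proof (cases "a = 1")
    case True
    then show ?thesis using two_chains_step_1[OF assms(1-3) c4] assms by auto
  next
    case False
    then have "1 < a" using assms(5) by simp
    then show ?thesis using two_chains_step_ge_2[OF assms(1-3) c4 _ assms(6-8)] by blast
  qed
qed

section \<open>Operators of order at most two on monomials\<close>

interpretation cpoly: vector_space "smult :: complex \<Rightarrow> complex poly \<Rightarrow> complex poly"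
  by (rule vector_space_smult)

text \<open>The polynomials supported in \<open>I\<close> form a subspace containing the generators;
  conversely a polynomial is the sum of its terms.\<close>

lemma monomial_span_iff: "f \<in> monomial_span I \<longleftrightarrow> (\<forall>j. coeff f j \<noteq> 0 \<longrightarrow> j \<in> I)"
proof
  assume "f \<in> monomial_span I"
  moreover have "monomial_span I \<subseteq> {f. \<forall>j. coeff f j \<noteq> 0 \<longrightarrow> j \<in> I}"
    unfolding monomial_span_def
  proof (rule cpoly.span_minimal)
    show "cpoly.subspace {f. \<forall>j. coeff f j \<noteq> 0 \<longrightarrow> j \<in> I}"
      by (rule cpoly.subspaceI) (auto, metis add.right_neutral)
  qed (auto split: if_splits)
  ultimately show "\<forall>j. coeff f j \<noteq> 0 \<longrightarrow> j \<in> I" by blast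
next
  assume *: "\<forall>j. coeff f j \<noteq> 0 \<longrightarrow> j \<in> I"
  have "monom (coeff f i) i \<in> monomial_span I" for i
  proof (cases "coeff f i = 0")
    case True
    then show ?thesis unfolding monomial_span_def by (simp add: cpoly.span_zero)
  next
    case False
    then have "smult (coeff f i) (monom 1 i) \<in> monomial_span I"
      unfolding monomial_span_def using * by (intro cpoly.span_scale cpoly.span_base) auto
    then show ?thesis by (simp add: smult_monom)
  qed
  then have "(\<Sum>i\<le>degree f. monom (coeff f i) i) \<in> monomial_span I"
    unfolding monomial_span_def by (intro cpoly.span_sum) auto
  then show "f \<in> monomial_span I" by (simp add: poly_as_sum_of_monoms)
qed

section \<open>Closure, linearity and tests on monomials for operators of order at most two\<close>

lemma diff_op_2: "diff_op 2 P f = P 0 * f + P 1 * pderiv f + P 2 * pderiv (pderiv f)"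
  by (simp add: diff_op_def numeral_2_eq_2)

lemma diff_ops_le_2_iff:
  "T \<in> diff_ops_le 2 \<longleftrightarrow> (\<exists>P0 P1 P2. T = (\<lambda>f. P0 * f + P1 * pderiv f + P2 * pderiv (pderiv f)))"
proof
  assume "T \<in> diff_ops_le 2"
  then show "\<exists>P0 P1 P2. T = (\<lambda>f. P0 * f + P1 * pderiv f + P2 * pderiv (pderiv f))"
    unfolding diff_ops_le_def image_iff fun_eq_iff diff_op_2 by blast
next
  assume "\<exists>P0 P1 P2. T = (\<lambda>f. P0 * f + P1 * pderiv f + P2 * pderiv (pderiv f))"
  then obtain P0 P1 P2 where T: "T = (\<lambda>f. P0 * f + P1 * pderiv f + P2 * pderiv (pderiv f))"
    by blast
  \<comment> \<open>The sum stops at index 2, so the last branch is also the default for all larger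
    indices.\<close>
  have "T = diff_op 2 (\<lambda>i. if i = 0 then P0 else if i = 1 then P1 else P2)"
    by (simp add: T fun_eq_iff diff_op_2)
  then show "T \<in> diff_ops_le 2" unfolding diff_ops_le_def by blast
qed

lemma diff_ops_le_2_I:
  "(\<And>f. T f = P0 * f + P1 * pderiv f + P2 * pderiv (pderiv f)) \<Longrightarrow> T \<in> diff_ops_le 2"
  unfolding diff_ops_le_2_iff by blast

lemma diff_ops_le_2_add:
  assumes "S \<in> diff_ops_le 2" "T \<in> diff_ops_le 2"
  shows "(\<lambda>f. S f + T f) \<in> diff_ops_le 2"
proof -
  obtain P0 P1 P2 Q0 Q1 Q2 where "S = (\<lambda>f. P0 * f + P1 * pderiv f + P2 * pderiv (pderiv f))"
    "T = (\<lambda>f. Q0 * f + Q1 * pderiv f + Q2 * pderiv (pderiv f))"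
    using assms unfolding diff_ops_le_2_iff by blast
  then show ?thesis
    by (intro diff_ops_le_2_I[of _ "P0 + Q0" "P1 + Q1" "P2 + Q2"]) (simp add: algebra_simps)
qed

lemma diff_ops_le_2_mult:
  assumes "T \<in> diff_ops_le 2"
  shows "(\<lambda>f. Q * T f) \<in> diff_ops_le 2"
proof -
  obtain P0 P1 P2 where "T = (\<lambda>f. P0 * f + P1 * pderiv f + P2 * pderiv (pderiv f))"
    using assms unfolding diff_ops_le_2_iff by blast
  then show ?thesis
    by (intro diff_ops_le_2_I[of _ "Q * P0" "Q * P1" "Q * P2"]) (simp add: algebra_simps)
qed

lemma diff_ops_le_2_smult:
  assumes "T \<in> diff_ops_le 2"
  shows "(\<lambda>f. smult c (T f)) \<in> diff_ops_le 2"
  using diff_ops_le_2_mult[OF assms, of "[:c:]"] by simp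

lemma diff_ops_le_2_xpow:
  assumes "T \<in> diff_ops_le 2"
  shows "(\<lambda>f. xpow k (T f)) \<in> diff_ops_le 2"
  unfolding xpow_def by (rule diff_ops_le_2_mult[OF assms])

lemma monom_1_Suc_0: "monom 1 (Suc 0) = [:0, 1:]"
  by (simp add: monom_Suc monom_0)

lemma xD_minus_eq: "xD_minus c f = [:0, 1:] * pderiv f - [:c:] * f"
  by (simp add: xD_minus_def xpow_def monom_1_Suc_0)

lemma pderiv_xD_minus:
  "pderiv (xD_minus c f) = [:1 - c:] * pderiv f + [:0, 1:] * pderiv (pderiv f)"
  unfolding xD_minus_eq pderiv_diff pderiv_mult
  by (simp add: pderiv_pCons algebra_simps flip: smult_add_left)

lemma diff_ops_le_2_basic:
  "(\<lambda>f. f) \<in> diff_ops_le 2"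
  "pderiv \<in> diff_ops_le 2"
  "(\<lambda>f. pderiv (pderiv f)) \<in> diff_ops_le 2"
  "(\<lambda>f. 0) \<in> diff_ops_le 2"
  "(\<lambda>f. pderiv (xD_minus c f)) \<in> diff_ops_le 2"
  "(\<lambda>f. xD_minus c (xD_minus d f)) \<in> diff_ops_le 2"
proof -
  show "(\<lambda>f. f) \<in> diff_ops_le 2" by (rule diff_ops_le_2_I[of _ 1 0 0]) simp
  show "pderiv \<in> diff_ops_le 2" by (rule diff_ops_le_2_I[of _ 0 1 0]) simp
  show "(\<lambda>f. pderiv (pderiv f)) \<in> diff_ops_le 2" by (rule diff_ops_le_2_I[of _ 0 0 1]) simp
  show "(\<lambda>f. 0) \<in> diff_ops_le 2" by (rule diff_ops_le_2_I[of _ 0 0 0]) simp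
  show "(\<lambda>f. pderiv (xD_minus c f)) \<in> diff_ops_le 2"
    by (rule diff_ops_le_2_I[of _ 0 "[:1 - c:]" "[:0, 1:]"]) (simp add: pderiv_xD_minus)
  show "(\<lambda>f. xD_minus c (xD_minus d f)) \<in> diff_ops_le 2"
    unfolding xD_minus_eq[of c] pderiv_xD_minus unfolding xD_minus_eq[of d]
    \<comment> \<open>With D for \<open>pderiv\<close>, (xD - c)(xD - d) = x^2 D^2 + (1 - c - d) x D
      + c d.\<close>
    by (rule diff_ops_le_2_I[of _ "[:c * d:]" "[:0, 1 - c - d:]" "[:0, 0, 1:]"])
      (simp add: algebra_simps smult_diff_left smult_add_left)
qed

lemmas diff_ops_le_2_intros =
  diff_ops_le_2_add diff_ops_le_2_smult diff_ops_le_2_xpow diff_ops_le_2_basic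

lemma diff_ops_le_2_linear:
  assumes "T \<in> diff_ops_le 2"
  shows "T (f + g) = T f + T g" "T (smult c f) = smult c (T f)"
  using assms unfolding diff_ops_le_2_iff
  by (auto simp: pderiv_add pderiv_smult algebra_simps smult_add_right)

text \<open>Linearity makes both equality of operators and preservation of the span testable on
  monomials.\<close>

lemma diff_ops_le_2_sum:
  assumes "T \<in> diff_ops_le 2"
  shows "T f = (\<Sum>i\<le>degree f. smult (coeff f i) (T (monom 1 i)))"
proof -
  have zero: "T 0 = 0" using diff_ops_le_2_linear(2)[OF assms, of 0 0] by simp
  have "T (\<Sum>i\<in>A. smult (c i) (monom 1 i)) = (\<Sum>i\<in>A. smult (c i) (T (monom 1 i)))"
    if "finite A" for A :: "nat set" and c
    using that by (induction A) (simp_all add: zero diff_ops_le_2_linear[OF assms])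
  from this[of "{..degree f}" "coeff f"] show ?thesis
    by (simp add: smult_monom poly_as_sum_of_monoms)
qed

lemma diff_ops_le_2_eqI:
  assumes "S \<in> diff_ops_le 2" "T \<in> diff_ops_le 2" "\<And>n. S (monom 1 n) = T (monom 1 n)"
  shows "S = T"
proof
  fix f
  show "S f = T f"
    unfolding diff_ops_le_2_sum[OF assms(1), of f] diff_ops_le_2_sum[OF assms(2), of f] assms(3) ..
qed

lemma preserving_ops_2_iff:
  "T \<in> preserving_ops 2 (monomial_span I) \<longleftrightarrow>
    T \<in> diff_ops_le 2 \<and> (\<forall>i\<in>I. T (monom 1 i) \<in> monomial_span I)"
proof (intro iffI conjI ballI)
  fix i assume "T \<in> preserving_ops 2 (monomial_span I)" "i \<in> I"
  moreover have "monom 1 i \<in> monomial_span I"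
    using \<open>i \<in> I\<close> by (simp add: monomial_span_iff)
  ultimately show "T (monom 1 i) \<in> monomial_span I" by (auto simp: preserving_ops_def)
next
  assume T: "T \<in> diff_ops_le 2 \<and> (\<forall>i\<in>I. T (monom 1 i) \<in> monomial_span I)"
  have "T f \<in> monomial_span I" if f: "f \<in> monomial_span I" for f
  proof -
    have "smult (coeff f i) (T (monom 1 i)) \<in> monomial_span I" for i
      using T f by (cases "coeff f i = 0") (auto simp: monomial_span_iff)
    then have "(\<Sum>i\<le>degree f. smult (coeff f i) (T (monom 1 i))) \<in> monomial_span I"
      unfolding monomial_span_def by (intro cpoly.span_sum) auto
    then show ?thesis using diff_ops_le_2_sum[OF conjunct1[OF T], of f] by metis
  qed
  then show "T \<in> preserving_ops 2 (monomial_span I)" using T by (auto simp: preserving_ops_def)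
qed (simp add: preserving_ops_def)

text \<open>\<open>symb A B C k n\<close> is the coefficient of \<open>x\<^sup>n\<^sup>+\<^sup>k\<close> in the image of \<open>x\<^sup>n\<close>, where \<open>A k\<close>, \<open>B k\<close>, \<open>C k\<close> are
  the coefficients of \<open>x\<^sup>k\<^sup>+\<^sup>2\<partial>\<^sup>2\<close>, \<open>x\<^sup>k\<^sup>+\<^sup>1\<partial>\<close>, \<open>x\<^sup>k\<close> in the operator.\<close>

definition symb :: "(int \<Rightarrow> complex) \<Rightarrow> (int \<Rightarrow> complex) \<Rightarrow> (int \<Rightarrow> complex) \<Rightarrow> int \<Rightarrow> nat \<Rightarrow> complex" where
  "symb A B C k n = A k * of_nat n * (of_nat n - 1) + B k * of_nat n + C k"

section \<open>Zeros of the quadratic symbols\<close>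

text \<open>The symbol is a polynomial of degree at most 2 in \<open>n\<close>. Divided differences
  eliminate first \<open>C k\<close>, then \<open>B k\<close>, and leave
  \<open>A k = 0\<close>.\<close>

lemma symb_eq_0:
  assumes "symb A B C k r = 0" "symb A B C k s = 0" "symb A B C k t = 0" "r \<noteq> s" "r \<noteq> t" "s \<noteq> t"
  shows "symb A B C k n = 0"
proof -
  have ne: "of_nat r - of_nat s \<noteq> (0::complex)" "of_nat r - of_nat t \<noteq> (0::complex)" "of_nat s - of_nat t \<noteq> (0::complex)"
    using assms(4-6) by auto
  have "(of_nat r - of_nat s) * (A k * (of_nat r + of_nat s - 1) + B k) = symb A B C k r - symb A B C k s"
    "(of_nat r - of_nat t) * (A k * (of_nat r + of_nat t - 1) + B k) = symb A B C k r - symb A B C k t"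
    by (simp_all add: symb_def algebra_simps)
  then have 1: "A k * (of_nat r + of_nat s - 1) + B k = 0" "A k * (of_nat r + of_nat t - 1) + B k = 0"
    using assms(1-3) ne by auto
  have "(of_nat s - of_nat t) * A k = (A k * (of_nat r + of_nat s - 1) + B k) - (A k * (of_nat r + of_nat t - 1) + B k)"
    by (simp add: algebra_simps)
  then have "A k = 0" using 1 ne by simp
  moreover from this 1 have "B k = 0" by simp
  ultimately show ?thesis using assms(1) by (simp add: symb_def)
qed

text \<open>The leading coefficient \<open>A k\<close> is the one remaining scalar; it becomes the
  parameter of the listed operator of shift \<open>k\<close>.\<close>

lemma symb_two_zeros:
  assumes "symb A B C k r = 0" "symb A B C k s = 0" "r \<noteq> s"
  shows "symb A B C k n = A k * (of_nat n - of_nat r) * (of_nat n - of_nat s)"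
proof -
  have ne: "of_nat r - of_nat s \<noteq> (0::complex)"
    using assms(3) by auto
  have "(of_nat r - of_nat s) * (A k * (of_nat r + of_nat s - 1) + B k) = symb A B C k r - symb A B C k s"
    by (simp add: symb_def algebra_simps)
  then have "A k * (of_nat r + of_nat s - 1) + B k = 0"
    using assms ne by auto
  then have B: "B k = - A k * (of_nat r + of_nat s - 1)"
    by (simp add: eq_neg_iff_add_eq_0 add.commute)
  have C: "C k = - A k * of_nat r * (of_nat r - 1) - B k * of_nat r"
    using assms(1) by (simp add: symb_def algebra_simps eq_neg_iff_add_eq_0)
  show ?thesis unfolding symb_def C B by (simp add: algebra_simps)
qed

lemma diff_ops_le_2_symb:
  assumes "T \<in> diff_ops_le 2"
  obtains A B C where "\<And>n j. coeff (T (monom 1 n)) j = symb A B C (int j - int n) n"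
    and "\<And>n k. int n + k < 0 \<Longrightarrow> symb A B C k n = 0"
proof -
  obtain P0 P1 P2 where T: "T = (\<lambda>f. P0 * f + P1 * pderiv f + P2 * pderiv (pderiv f))"
    using assms unfolding diff_ops_le_2_iff by blast
  \<comment> \<open>Coefficients are extended by zero to negative indices, so that all integer
    shifts are treated uniformly.\<close>
  define cf where "cf P k = (if k < 0 then 0 else coeff P (nat k))" for P :: "complex poly" and k
  define A B C where "A k = cf P2 (k + 2)" and "B k = cf P1 (k + 1)" and "C k = cf P0 k" for k
  have mon: "coeff (P * monom c n) j = cf P (int j - int n) * c" for P c n j
    using coeff_monom_mult[of c n P j] by (auto simp: cf_def mult.commute nat_diff_distrib')
  \<comment> \<open>The factor \<open>of_nat n\<close>, and below
    \<open>of_nat n * of_nat (n - 1)\<close>, is zero exactly where truncated subtraction would give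
    a wrong exponent.\<close>
  have 1: "of_nat n * cf P (int j - int (n - 1)) = of_nat n * cf P (int j - int n + 1)" for P n j
    by (cases n) (auto simp: algebra_simps)
  have 2: "of_nat n * of_nat (n - 1) * cf P (int j - int (n - 1 - 1))
      = of_nat n * (of_nat n - 1) * cf P (int j - int n + 2)" for P n j
    by (cases n; cases "n - 1") (auto simp: algebra_simps)
  show thesis
  proof
    fix n j
    show "coeff (T (monom 1 n)) j = symb A B C (int j - int n) n"
      using 1[of n P1 j] 2[of n P2 j]
      by (simp add: T symb_def A_def B_def C_def mon pderiv_monom algebra_simps)
  next
    fix n k
    assume "int n + k < 0"
    \<comment> \<open>For \<open>k < -2\<close> all three coefficients are zero; in the other cases
      the surviving terms carry a factor \<open>n\<close> or \<open>n * (n - 1)\<close> that is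
      zero.\<close>
    then consider "k < -2" | "k = -2" "n = 0" | "k = -2" "n = 1" | "k = -1" "n = 0"
      by linarith
    then show "symb A B C k n = 0"
      by cases (auto simp: symb_def A_def B_def C_def cf_def)
  qed
qed

section \<open>Action of the building blocks on monomials\<close>

lemma xpow_monom: "xpow k (monom c n) = monom c (n + k)"
  by (simp add: xpow_def mult_monom add.commute)

lemma xD_minus_monom: "xD_minus d (monom c n) = monom ((of_nat n - d) * c) n"
  by (cases n) (simp_all add: xD_minus_def xpow_def mult_monom pderiv_monom diff_monom add_monom minus_monom
    smult_monom algebra_simps)

text \<open>Every building block is homogeneous. Writing each condition as a value of the shift
  \<open>int j - int n\<close> lets a whole family be evaluated at one fixed shift.\<close>

lemma coeff_op_monom:
  "coeff (xpow p (xD_minus c (xD_minus d (monom 1 n)))) j =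
    (if int j - int n = int p then (of_nat n - c) * (of_nat n - d) else 0)"
  "coeff (xpow p (pderiv (xD_minus c (monom 1 n)))) j =
    (if int j - int n = int p - 1 then of_nat n * (of_nat n - c) else 0)"
  "coeff (xpow p (pderiv (pderiv (monom 1 n)))) j =
    (if int j - int n = int p - 2 then of_nat n * (of_nat n - 1) else 0)"
  "coeff (xpow p (pderiv (monom 1 n))) j =
    (if int j - int n = int p - 1 then of_nat n else 0)"
  "coeff (pderiv (xD_minus c (monom 1 n))) j =
    (if int j - int n = - 1 then of_nat n * (of_nat n - c) else 0)"
  "coeff (pderiv (pderiv (monom (1::complex) n))) j =
    (if int j - int n = - 2 then of_nat n * (of_nat n - 1) else 0)"
  "coeff (monom (1::complex) n) j = (if int j - int n = 0 then 1 else 0)"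
proof -
  have dd: "pderiv (pderiv (monom (1::complex) n)) = monom (of_nat n * (of_nat n - 1)) (n - 2)"
    by (cases n) (simp_all add: pderiv_monom numeral_2_eq_2 algebra_simps)
  \<comment> \<open>Truncated subtraction is exact for \<open>q \<le> n\<close>; otherwise the
    coefficient \<open>b\<close> is zero.\<close>
  have shift: "(if n - q + p = j then b else 0) = (if int j - int n = int p - int q then b else 0)"
    if "q \<le> n \<or> b = 0" for p q and b :: complex
  proof (cases "q \<le> n")
    case True
    then have "n - q + p = j \<longleftrightarrow> int j - int n = int p - int q" by linarith
    then show ?thesis by simp
  next
    case False
    then show ?thesis using that by simp
  qed
  have "of_nat n * (of_nat n - 1) = (0::complex)" if "\<not> 2 \<le> n"
  proof -
    have "n = 0 \<or> n = 1" using that by linarith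
    then show ?thesis by auto
  qed
  then have 2: "(if n - 2 + p = j then of_nat n * (of_nat n - 1) else 0) =
    (if int j - int n = int p - 2 then of_nat n * (of_nat n - 1) else (0::complex))" for p
    using shift[of 2 "of_nat n * (of_nat n - 1)" p] by fastforce
  have 1: "(if n - 1 + p = j then of_nat n * a else 0) =
    (if int j - int n = int p - 1 then of_nat n * a else (0::complex))" for p a
    using shift[of 1 "of_nat n * a" p] by (cases n) auto
  show "coeff (xpow p (xD_minus c (xD_minus d (monom 1 n)))) j =
    (if int j - int n = int p then (of_nat n - c) * (of_nat n - d) else 0)"
    unfolding xpow_monom xD_minus_monom coeff_monom by auto
  show "coeff (xpow p (pderiv (xD_minus c (monom 1 n)))) j =
    (if int j - int n = int p - 1 then of_nat n * (of_nat n - c) else 0)"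
    unfolding xpow_monom xD_minus_monom pderiv_monom coeff_monom mult_1_right by (rule 1)
  show "coeff (xpow p (pderiv (pderiv (monom 1 n)))) j =
    (if int j - int n = int p - 2 then of_nat n * (of_nat n - 1) else 0)"
    unfolding dd xpow_monom coeff_monom by (rule 2)
  show "coeff (xpow p (pderiv (monom 1 n))) j =
    (if int j - int n = int p - 1 then of_nat n else 0)"
    unfolding xpow_monom pderiv_monom coeff_monom using 1[where a = 1] by simp
  show "coeff (pderiv (xD_minus c (monom 1 n))) j =
    (if int j - int n = - 1 then of_nat n * (of_nat n - c) else 0)"
    unfolding xD_minus_monom pderiv_monom coeff_monom mult_1_right using 1[of 0] by simp
  show "coeff (pderiv (pderiv (monom (1::complex) n))) j =
    (if int j - int n = - 2 then of_nat n * (of_nat n - 1) else 0)"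
    unfolding dd coeff_monom using 2[of 0] by simp
  show "coeff (monom (1::complex) n) j = (if int j - int n = 0 then 1 else 0)"
    by auto
qed

lemma monomial_span_closed:
  "f \<in> monomial_span I \<Longrightarrow> g \<in> monomial_span I \<Longrightarrow> f + g \<in> monomial_span I"
  "f \<in> monomial_span I \<Longrightarrow> smult c f \<in> monomial_span I"
  "0 \<in> monomial_span I"
  "(b \<Longrightarrow> f \<in> monomial_span I) \<Longrightarrow> (\<not> b \<Longrightarrow> g \<in> monomial_span I) \<Longrightarrow>
    (if b then f else g) \<in> monomial_span I"
  unfolding monomial_span_def by (simp_all add: cpoly.span_add cpoly.span_scale cpoly.span_zero)

text \<open>Either the scalar factor of the image vanishes or its exponent lies in
  \<open>I\<close>.\<close>

lemma op_monom_in_monomial_span: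
  "of_nat i = c \<or> of_nat i = d \<or> i + p \<in> I \<Longrightarrow>
    xpow p (xD_minus c (xD_minus d (monom 1 i))) \<in> monomial_span I"
  "i = 0 \<or> of_nat i = c \<or> i + p - 1 \<in> I \<Longrightarrow>
    xpow p (pderiv (xD_minus c (monom 1 i))) \<in> monomial_span I"
  "i \<le> 1 \<or> i + p - 2 \<in> I \<Longrightarrow> xpow p (pderiv (pderiv (monom 1 i))) \<in> monomial_span I"
  "i = 0 \<or> i + p - 1 \<in> I \<Longrightarrow> xpow p (pderiv (monom 1 i)) \<in> monomial_span I"
  "i = 0 \<or> of_nat i = c \<or> i - 1 \<in> I \<Longrightarrow> pderiv (xD_minus c (monom 1 i)) \<in> monomial_span I"
  "i \<le> 1 \<or> i - 2 \<in> I \<Longrightarrow> pderiv (pderiv (monom 1 i)) \<in> monomial_span I"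
  "i \<in> I \<Longrightarrow> monom 1 i \<in> monomial_span I"
proof -
  \<comment> \<open>A natural \<open>j\<close> at distance \<open>e\<close> from \<open>i\<close>
    can only be \<open>i + p - q\<close>, and then this subtraction is not truncated.\<close>
  have *: "\<forall>j. (if int j - int i = e then a else 0) \<noteq> 0 \<longrightarrow> j \<in> I"
    if "a = 0 \<or> i + p - q \<in> I" "e = int p - int q" for a :: complex and e p q
  proof (intro allI impI)
    fix j assume j: "(if int j - int i = e then a else 0) \<noteq> 0"
    then have "int j - int i = int p - int q" using that(2) by (auto split: if_splits)
    then have "j = i + p - q" by linarith
    then show "j \<in> I" using that(1) j by (auto split: if_splits)
  qed
  have le1: "of_nat i * (of_nat i - 1) = (0::complex)" if "i \<le> 1"
    using that by (cases "i = 0") auto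
  show "of_nat i = c \<or> of_nat i = d \<or> i + p \<in> I \<Longrightarrow>
    xpow p (xD_minus c (xD_minus d (monom 1 i))) \<in> monomial_span I"
    unfolding monomial_span_iff coeff_op_monom by (rule *[of _ p 0]) (auto simp: le1)
  show "i = 0 \<or> of_nat i = c \<or> i + p - 1 \<in> I \<Longrightarrow>
    xpow p (pderiv (xD_minus c (monom 1 i))) \<in> monomial_span I"
    unfolding monomial_span_iff coeff_op_monom by (rule *[of _ p 1]) (auto simp: le1)
  show "i \<le> 1 \<or> i + p - 2 \<in> I \<Longrightarrow> xpow p (pderiv (pderiv (monom 1 i))) \<in> monomial_span I"
    unfolding monomial_span_iff coeff_op_monom by (rule *[of _ p 2]) (auto simp: le1)
  show "i = 0 \<or> i + p - 1 \<in> I \<Longrightarrow> xpow p (pderiv (monom 1 i)) \<in> monomial_span I"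
    unfolding monomial_span_iff coeff_op_monom by (rule *[of _ p 1]) (auto simp: le1)
  show "i = 0 \<or> of_nat i = c \<or> i - 1 \<in> I \<Longrightarrow> pderiv (xD_minus c (monom 1 i)) \<in> monomial_span I"
    unfolding monomial_span_iff coeff_op_monom by (rule *[of _ 0 1]) (auto simp: le1)
  show "i \<le> 1 \<or> i - 2 \<in> I \<Longrightarrow> pderiv (pderiv (monom 1 i)) \<in> monomial_span I"
    unfolding monomial_span_iff coeff_op_monom by (rule *[of _ 0 2]) (auto simp: le1)
  show "i \<in> I \<Longrightarrow> monom 1 i \<in> monomial_span I"
    by (auto simp: monomial_span_iff)
qed

lemma diff_ops_le_2_if:
  "(b \<Longrightarrow> S \<in> diff_ops_le 2) \<Longrightarrow> (\<not> b \<Longrightarrow> T \<in> diff_ops_le 2) \<Longrightarrow>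
    (\<lambda>f. if b then S f else T f) \<in> diff_ops_le 2"
  by (cases b) simp_all

text \<open>Reduces each form to a computation with symbols: \<open>complete\<close> asks that all
  symbols with the forced zeros be realized by parameters. The conditions for negative shifts
  include every \<open>i < d\<close>, in \<open>I\<close> or not, because coefficients have no
  negative powers.\<close>

lemma preserving_ops_2_eq_range:
  assumes "\<And>\<alpha>. F \<alpha> \<in> diff_ops_le 2"
    and "\<And>\<alpha> i. i \<in> I \<Longrightarrow> F \<alpha> (monom 1 i) \<in> monomial_span I"
    and complete: "\<And>A B C. (\<And>d i. i \<in> I \<Longrightarrow> i + d \<notin> I \<Longrightarrow> symb A B C (int d) i = 0) \<Longrightarrow>
      (\<And>d i. i < d \<or> i \<in> I \<and> i - d \<notin> I \<Longrightarrow> symb A B C (- int d) i = 0) \<Longrightarrow>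
      \<exists>\<alpha>. \<forall>n j. coeff (F \<alpha> (monom 1 n)) j = symb A B C (int j - int n) n"
  shows "preserving_ops 2 (monomial_span I) = range F"
proof (intro equalityI subsetI)
  fix T assume T: "T \<in> preserving_ops 2 (monomial_span I)"
  then have T2: "T \<in> diff_ops_le 2" and TI: "\<And>i. i \<in> I \<Longrightarrow> T (monom 1 i) \<in> monomial_span I"
    by (simp_all add: preserving_ops_2_iff)
  obtain A B C where s: "\<And>n j. coeff (T (monom 1 n)) j = symb A B C (int j - int n) n"
    and neg: "\<And>n k. int n + k < 0 \<Longrightarrow> symb A B C k n = 0"
    using diff_ops_le_2_symb[OF T2] by metis
  have 0: "symb A B C (int j - int i) i = 0" if "i \<in> I" "j \<notin> I" for i j
    using TI[OF that(1)] that(2) s[of i j] unfolding monomial_span_iff by metis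
  have "\<exists>\<alpha>. \<forall>n j. coeff (F \<alpha> (monom 1 n)) j = symb A B C (int j - int n) n"
  proof (rule complete)
    fix d i assume "i \<in> I" "i + d \<notin> I"
    then show "symb A B C (int d) i = 0" using 0[of i "i + d"] by simp
  next
    fix d i assume "i < d \<or> i \<in> I \<and> i - d \<notin> I"
    then show "symb A B C (- int d) i = 0"
      using 0[of i "i - d"] neg[of i "- int d"] by (cases "i < d") (auto simp: of_nat_diff)
  qed
  then obtain \<alpha> where "\<And>n j. coeff (F \<alpha> (monom 1 n)) j = symb A B C (int j - int n) n"
    by blast
  then have "T (monom 1 n) = F \<alpha> (monom 1 n)" for n
    by (intro poly_eqI) (simp add: s)
  then have "T = F \<alpha>" by (rule diff_ops_le_2_eqI[OF T2 assms(1)])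
  then show "T \<in> range F" by blast
next
  fix T assume "T \<in> range F"
  then show "T \<in> preserving_ops 2 (monomial_span I)"
    using assms(1,2) by (auto simp: preserving_ops_2_iff)
qed

lemma symb_at_0: "symb A B C 0 n = A 0 * (of_nat n * (of_nat n - 1)) + B 0 * of_nat n + C 0"
  by (simp add: symb_def)

text \<open>Isolates -1 and -2, the only negative shifts that can carry an operator: for shifts at
  most -3 the points 0, 1, 2 are forced zeros.\<close>

lemma int_shift_cases:
  obtains d where "(k::int) = int d" | "k = - int 1" | "k = - int 2" | d where "k = - int d" "3 \<le> d"
proof -
  consider "0 \<le> k" | "k = - 1" | "k = - 2" | "k \<le> - 3" by linarith
  then show thesis
    by cases (auto intro: that(1)[of "nat k"] that(2,3) that(4)[of "nat (- k)"])
qed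

section \<open>The operators in the four cases\<close>

text \<open>Each of the shifts \<open>l + m\<close>, \<open>l\<close>, \<open>m\<close> has exactly
  two forced zeros, hence one parameter, and shift 0 has none, hence three. The extra terms come
  from the shifts -1 and -2.\<close>

lemma preserving_form_A:
  assumes "form_A I m l"
  shows "preserving_ops 2 (monomial_span I) = range (T2_A m l)"
proof (rule preserving_ops_2_eq_range)
  have ml: "1 \<le> m" "1 \<le> l" "l \<noteq> m" and I: "I = {0, m, m + l}"
    using assms by (auto simp: form_A_def)
  show "T2_A m l \<alpha> \<in> diff_ops_le 2" for \<alpha>
    unfolding T2_A_def T2_A_extra_def by (intro diff_ops_le_2_intros diff_ops_le_2_if)
  show "T2_A m l \<alpha> (monom 1 i) \<in> monomial_span I" if "i \<in> I" for \<alpha> i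
    unfolding T2_A_def T2_A_extra_def
    by (intro monomial_span_closed op_monom_in_monomial_span) (use that ml in \<open>auto simp: I\<close>)
  fix A B C
  let ?s = "symb A B C"
  assume pos: "\<And>d i. i \<in> I \<Longrightarrow> i + d \<notin> I \<Longrightarrow> ?s (int d) i = 0"
    and neg: "\<And>d i. i < d \<or> i \<in> I \<and> i - d \<notin> I \<Longrightarrow> ?s (- int d) i = 0"
  have s1: "?s (int (l + m)) n = A (int (l + m)) * (of_nat n - of_nat m) * (of_nat n - of_nat (l + m))" for n
    by (rule symb_two_zeros[OF pos pos]) (use I ml in auto)
  have s2: "?s (int l) n = A (int l) * (of_nat n - of_nat 0) * (of_nat n - of_nat (l + m))" for n
    by (rule symb_two_zeros[OF pos pos]) (use I ml in auto)
  have s3: "?s (int m) n = A (int m) * (of_nat n - of_nat m) * (of_nat n - of_nat (l + m))" for n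
    by (rule symb_two_zeros[OF pos pos]) (use I ml in auto)
  have s4: "?s (int d) n = 0" if "d \<notin> {0, l, m, l + m}" for d n
    by (rule symb_eq_0[where r = 0 and s = m and t = "m + l", OF pos pos pos]) (use I ml that in auto)
  have s5: "?s (- int d) n = 0" if "3 \<le> d" for d n
    by (rule symb_eq_0[where r = 0 and s = 1 and t = 2, OF neg neg neg]) (use that in auto)
  have s6: "?s (- int 1) n = A (- int 1) * (of_nat n - of_nat 0) * (of_nat n - of_nat (l + m))" if "m = 1" for n
    by (rule symb_two_zeros[OF neg neg]) (use I ml that in auto)
  have s7: "?s (- int 1) n = A (- int 1) * (of_nat n - of_nat 0) * (of_nat n - of_nat m)" if "l = 1" for n
    by (rule symb_two_zeros[OF neg neg]) (use I ml that in auto)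
  have s8: "?s (- int 1) n = 0" if "m \<noteq> 1" "l \<noteq> 1" for n
    by (rule symb_eq_0[where r = 0 and s = m and t = "l + m", OF neg neg neg]) (use I ml that in auto)
  have s9: "?s (- int 2) n = A (- int 2) * (of_nat n - of_nat 0) * (of_nat n - of_nat 1)" for n
    by (rule symb_two_zeros[OF neg neg]) auto
  \<comment> \<open>Besides 0 and 1 a third zero is \<open>l + m\<close> or \<open>m\<close>. For
    \<open>m = 1\<close>, \<open>l = 2\<close> it is missing, since \<open>l + m - 2 = 1\<close>
    lies in \<open>I\<close>; this is where the term with \<open>\<alpha> 8\<close>
    survives.\<close>
  have s10: "?s (- int 2) n = 0" if "\<not> (m = 1 \<and> l = 2)" for n
  proof -
    consider "m = 1" | "m = 2" | "3 \<le> m" using ml by linarith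
    then show ?thesis
    proof cases
      case 1
      show ?thesis
        by (rule symb_eq_0[where r = 0 and s = 1 and t = "l + m", OF neg neg neg]) (use I ml that 1 in auto)
    next
      case 2
      show ?thesis
        by (rule symb_eq_0[where r = 0 and s = 1 and t = "l + m", OF neg neg neg]) (use I ml that 2 in auto)
    next
      case 3
      show ?thesis
        by (rule symb_eq_0[where r = 0 and s = 1 and t = m, OF neg neg neg]) (use I ml that 3 in auto)
    qed
  qed
  \<comment> \<open>The parameters are the leading coefficients of the symbols, with
    \<open>B 0\<close> and \<open>C 0\<close> added at shift 0. As \<open>l \<noteq> m\<close>, the
    cases \<open>m = 1\<close> and \<open>l = 1\<close> exclude each other and can share
    \<open>\<alpha> 7\<close>.\<close>
  define \<alpha> :: "nat \<Rightarrow> complex" where "\<alpha> = (\<lambda>_. 0)(1 := A (int (l + m)), 2 := A (int l), 3 := A (int m),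
    4 := A 0, 5 := B 0, 6 := C 0, 7 := A (- 1), 8 := A (- 2))"
  have \<alpha>: "\<alpha> 1 = A (int (l + m))" "\<alpha> 2 = A (int l)" "\<alpha> 3 = A (int m)"
    "\<alpha> 4 = A 0" "\<alpha> 5 = B 0" "\<alpha> 6 = C 0" "\<alpha> 7 = A (- 1)" "\<alpha> 8 = A (- 2)"
    by (simp_all add: \<alpha>_def)
  have "coeff (T2_A m l \<alpha> (monom 1 n)) j = ?s k n" if k: "int j - int n = k" for n j k
  proof -
    note T = T2_A_def T2_A_extra_def coeff_add coeff_smult coeff_op_monom \<alpha>
      if_distrib[of "\<lambda>f. coeff f j"] coeff_0 k
    show ?thesis
    proof (cases k rule: int_shift_cases)
      case (1 d)
      consider "d = 0" | "d = l" | "d = m" | "d = l + m" | "d \<notin> {0, l, m, l + m}" by blast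
      then show ?thesis
      proof cases
        case 5
        then show ?thesis unfolding T using ml 1 s4[of d n] by simp
      qed (unfold T, use ml 1 s1[of n] s2[of n] s3[of n] in \<open>simp_all add: symb_at_0\<close>)
    next
      case 2
      then show ?thesis unfolding T using ml s6[of n] s7[of n] s8[of n] by auto
    next
      case 3
      then show ?thesis unfolding T using ml s9[of n] s10[of n] by auto
    next
      case (4 d)
      then show ?thesis unfolding T using ml s5[of d n] by auto
    qed
  qed
  then show "\<exists>\<alpha>. \<forall>n j. coeff (T2_A m l \<alpha> (monom 1 n)) j = ?s (int j - int n) n" by blast
qed

lemma preserving_form_B:
  assumes "form_B I m l"
  shows "preserving_ops 2 (monomial_span I) = range (T2_B m l)"
proof (rule preserving_ops_2_eq_range)
  have ml: "1 \<le> m" "1 \<le> l" "l \<noteq> m" and I: "I = {0, m, m + l, 2 * m + l}"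
    using assms by (auto simp: form_B_def)
  show "T2_B m l \<alpha> \<in> diff_ops_le 2" for \<alpha>
    unfolding T2_B_def by (intro diff_ops_le_2_intros diff_ops_le_2_if)
  show "T2_B m l \<alpha> (monom 1 i) \<in> monomial_span I" if "i \<in> I" for \<alpha> i
    unfolding T2_B_def
    by (intro monomial_span_closed op_monom_in_monomial_span) (use that ml in \<open>auto simp: I\<close>)
  fix A B C
  let ?s = "symb A B C"
  assume pos: "\<And>d i. i \<in> I \<Longrightarrow> i + d \<notin> I \<Longrightarrow> ?s (int d) i = 0"
    and neg: "\<And>d i. i < d \<or> i \<in> I \<and> i - d \<notin> I \<Longrightarrow> ?s (- int d) i = 0"
  have s1: "?s (int (l + m)) x = A (int (l + m)) * (of_nat x - of_nat (2 * m + l)) * (of_nat x - of_nat (l + m))" for x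
    by (rule symb_two_zeros[OF pos pos]) (use I ml in auto)
  have s2: "?s (int m) x = A (int m) * (of_nat x - of_nat (2 * m + l)) * (of_nat x - of_nat m)" for x
    by (rule symb_two_zeros[OF pos pos]) (use I ml in auto)
  \<comment> \<open>Shift \<open>l\<close> keeps \<open>m\<close> in \<open>I\<close> but moves 0
    out because \<open>l \<noteq> m\<close>; every other shift considered moves \<open>m\<close>
    out.\<close>
  have s3: "?s (int d) x = 0" if "d \<notin> {0, m, l + m}" for d x
  proof (cases "d = l")
    case True
    show ?thesis
      by (rule symb_eq_0[where r = 0 and s = "m + l" and t = "2 * m + l", OF pos pos pos]) (use I ml that True in auto)
  next
    case False
    show ?thesis
      by (rule symb_eq_0[where r = m and s = "m + l" and t = "2 * m + l", OF pos pos pos]) (use I ml that False in auto)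
  qed
  have minus_ge_3: "?s (- int d) x = 0" if "3 \<le> d" for d x
    by (rule symb_eq_0[where r = 0 and s = 1 and t = 2, OF neg neg neg]) (use that in auto)
  have s4: "?s (- int 1) x = A (- int 1) * (of_nat x - of_nat 0) * (of_nat x - of_nat (m + l))" if "m = 1" for x
    by (rule symb_two_zeros[OF neg neg]) (use I ml that in auto)
  have s5: "?s (- int 1) x = 0" if "m \<noteq> 1" for x
    by (rule symb_eq_0[where r = 0 and s = m and t = "2 * m + l", OF neg neg neg]) (use I ml that in auto)
  \<comment> \<open>The third zero \<open>l + 2\<close> is \<open>2 * m + l\<close> for
    \<open>m = 1\<close> and \<open>m + l\<close> for \<open>m = 2\<close>; in both cases it moves
    to \<open>l\<close>, which is not in \<open>I\<close>.\<close>
  have s6: "?s (- int 2) x = 0" for x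
  proof -
    consider "m = 1" "l = 2" | "m = 1" "l \<noteq> 2" | "m = 2" | "3 \<le> m" using ml by linarith
    then show ?thesis
    proof cases
      case 1
      show ?thesis
        by (rule symb_eq_0[where r = 0 and s = 1 and t = "l + 2", OF neg neg neg]) (use I ml 1 in auto)
    next
      case 2
      show ?thesis
        by (rule symb_eq_0[where r = 0 and s = 1 and t = "l + 2", OF neg neg neg]) (use I ml 2 in auto)
    next
      case 3
      show ?thesis
        by (rule symb_eq_0[where r = 0 and s = 1 and t = "l + 2", OF neg neg neg]) (use I ml 3 in auto)
    next
      case 4
      show ?thesis
        by (rule symb_eq_0[where r = 0 and s = 1 and t = m, OF neg neg neg]) (use I ml 4 in auto)
    qed
  qed
  define \<alpha> :: "nat \<Rightarrow> complex" where "\<alpha> = (\<lambda>_. 0)(1 := A (int (l + m)), 2 := A (int m),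
    3 := A 0, 4 := B 0, 5 := C 0, 6 := A (- 1))"
  have \<alpha>: "\<alpha> 1 = A (int (l + m))" "\<alpha> 2 = A (int m)"
    "\<alpha> 3 = A 0" "\<alpha> 4 = B 0" "\<alpha> 5 = C 0" "\<alpha> 6 = A (- 1)"
    by (simp_all add: \<alpha>_def)
  have "coeff (T2_B m l \<alpha> (monom 1 x)) j = ?s k x" if k: "int j - int x = k" for x j k
  proof -
    note T = T2_B_def  coeff_add coeff_smult coeff_op_monom \<alpha>
      if_distrib[of "\<lambda>f. coeff f j"] coeff_0 k
    show ?thesis
    proof (cases k rule: int_shift_cases)
      case (1 d)
      consider "d = 0" | "d = m" | "d = l + m" | "d \<notin> {0, m, l + m}" by blast
      then show ?thesis
      proof cases
        case 4
        then show ?thesis unfolding T using ml 1 s3[of d x] by simp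
      qed (unfold T, use ml 1 s1[of x] s2[of x] in \<open>simp_all add: symb_at_0\<close>)
    next
      case 2
      then show ?thesis unfolding T using ml s4[of x] s5[of x] by auto
    next
      case 3
      then show ?thesis unfolding T using ml s6[of x] by auto
    next
      case (4 d)
      then show ?thesis unfolding T using ml minus_ge_3[of d x] by auto
    qed
  qed
  then show "\<exists>\<alpha>. \<forall>x j. coeff (T2_B m l \<alpha> (monom 1 x)) j = ?s (int j - int x) x" by blast
qed

lemma preserving_form_C:
  assumes "form_C I n"
  shows "preserving_ops 2 (monomial_span I) = range (T2_C n)"
proof (rule preserving_ops_2_eq_range)
  have ml: "4 \<le> n" and I: "I = {0..n - 2} \<union> {n}"
    using assms by (auto simp: form_C_def)
  \<comment> \<open>The constants are rewritten as natural numbers, so that they can be matched with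
    zeros at elements of \<open>I\<close>.\<close>
  have of_nat_eqs: "of_nat n - 3 = (of_nat (n - 3) :: complex)" "of_nat n - 2 = (of_nat (n - 2) :: complex)"
    using ml by (simp_all add: of_nat_diff)
  show "T2_C n \<alpha> \<in> diff_ops_le 2" for \<alpha>
    unfolding T2_C_def by (intro diff_ops_le_2_intros diff_ops_le_2_if)
  show "T2_C n \<alpha> (monom 1 i) \<in> monomial_span I" if "i \<in> I" for \<alpha> i
    unfolding T2_C_def of_nat_eqs
    by (intro monomial_span_closed op_monom_in_monomial_span) (use that ml in \<open>auto simp: I simp del: of_nat_diff\<close>)
  fix A B C
  let ?s = "symb A B C"
  assume pos: "\<And>d i. i \<in> I \<Longrightarrow> i + d \<notin> I \<Longrightarrow> ?s (int d) i = 0"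
    and neg: "\<And>d i. i < d \<or> i \<in> I \<and> i - d \<notin> I \<Longrightarrow> ?s (- int d) i = 0"
  have s1: "?s (int 2) x = A (int 2) * (of_nat x - of_nat n) * (of_nat x - of_nat (n - 3))" for x
    by (rule symb_two_zeros[OF pos pos]) (use I ml in auto)
  have s2: "?s (int 1) x = A (int 1) * (of_nat x - of_nat n) * (of_nat x - of_nat (n - 2))" for x
    by (rule symb_two_zeros[OF pos pos]) (use I ml in auto)
  \<comment> \<open>For \<open>d < n\<close> the point \<open>n - 1 - d\<close> lands in the gap
    \<open>n - 1\<close>. For \<open>d = n\<close> the point 0 lands on \<open>n\<close>, so 1 and 2
    are taken instead.\<close>
  have s3: "?s (int d) x = 0" if "3 \<le> d" for d x
  proof -
    consider "d < n" | "d = n" | "n < d" by linarith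
    then show ?thesis
    proof cases
      case 1
      show ?thesis
        by (rule symb_eq_0[where r = "n - 1 - d" and s = "n - 2" and t = n, OF pos pos pos]) (use I ml that 1 in auto)
    next
      case 2
      show ?thesis
        by (rule symb_eq_0[where r = 1 and s = 2 and t = n, OF pos pos pos]) (use I ml that 2 in auto)
    next
      case 3
      show ?thesis
        by (rule symb_eq_0[where r = 0 and s = 1 and t = n, OF pos pos pos]) (use I ml that 3 in auto)
    qed
  qed
  have minus_ge_3: "?s (- int d) x = 0" if "3 \<le> d" for d x
    by (rule symb_eq_0[where r = 0 and s = 1 and t = 2, OF neg neg neg]) (use that in auto)
  have s4: "?s (- int 1) x = A (- int 1) * (of_nat x - of_nat 0) * (of_nat x - of_nat n)" for x
    by (rule symb_two_zeros[OF neg neg]) (use I ml in auto)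
  \<comment> \<open>There is no third zero: \<open>n\<close> moves to \<open>n - 2\<close>, which
    lies in \<open>I\<close>, so the second derivative survives.\<close>
  have s5: "?s (- int 2) x = A (- int 2) * (of_nat x - of_nat 0) * (of_nat x - of_nat 1)" for x
    by (rule symb_two_zeros[OF neg neg]) auto
  define \<alpha> :: "nat \<Rightarrow> complex" where "\<alpha> = (\<lambda>_. 0)(1 := A 2, 2 := A 1,
    3 := A 0, 4 := B 0, 5 := C 0, 6 := A (- 1), 7 := A (- 2))"
  have \<alpha>: "\<alpha> 1 = A 2" "\<alpha> 2 = A 1"
    "\<alpha> 3 = A 0" "\<alpha> 4 = B 0" "\<alpha> 5 = C 0" "\<alpha> 6 = A (- 1)" "\<alpha> 7 = A (- 2)"
    by (simp_all add: \<alpha>_def)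
  have "coeff (T2_C n \<alpha> (monom 1 x)) j = ?s k x" if k: "int j - int x = k" for x j k
  proof -
    note T = T2_C_def of_nat_eqs coeff_add coeff_smult coeff_op_monom \<alpha>
      if_distrib[of "\<lambda>f. coeff f j"] coeff_0 k
    show ?thesis
    proof (cases k rule: int_shift_cases)
      case (1 d)
      consider "d = 0" | "d = 1" | "d = 2" | "3 \<le> d" by linarith
      then show ?thesis
      proof cases
        case 4
        then show ?thesis unfolding T using ml 1 s3[of d x] by simp
      qed (unfold T, use ml 1 s1[of x] s2[of x] in \<open>simp_all add: symb_at_0\<close>)
    next
      case 2
      then show ?thesis unfolding T using ml s4[of x] by auto
    next
      case 3
      then show ?thesis unfolding T using ml s5[of x] by auto
    next
      case (4 d)
      then show ?thesis unfolding T using ml minus_ge_3[of d x] by auto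
    qed
  qed
  then show "\<exists>\<alpha>. \<forall>x j. coeff (T2_C n \<alpha> (monom 1 x)) j = ?s (int j - int x) x" by blast
qed

lemma preserving_form_D:
  assumes "form_D I n"
  shows "preserving_ops 2 (monomial_span I) = range (T2_D n)"
proof (rule preserving_ops_2_eq_range)
  have ml: "4 \<le> n" and I: "I = {0} \<union> {2..n}"
    using assms by (auto simp: form_D_def)
  have of_nat_eqs: "of_nat n - 1 = (of_nat (n - 1) :: complex)"
    using ml by (simp add: of_nat_diff)
  show "T2_D n \<alpha> \<in> diff_ops_le 2" for \<alpha>
    unfolding T2_D_def by (intro diff_ops_le_2_intros diff_ops_le_2_if)
  show "T2_D n \<alpha> (monom 1 i) \<in> monomial_span I" if "i \<in> I" for \<alpha> i
    unfolding T2_D_def of_nat_eqs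
    \<comment> \<open>For \<open>i = 2\<close> the exponent \<open>i - 1\<close> is the gap 1, and
      the factor of \<open>xD_minus 2\<close> vanishes instead.\<close>
    by (cases "i = 2"; intro monomial_span_closed op_monom_in_monomial_span)
      (use that ml in \<open>auto simp: I simp del: of_nat_diff\<close>)
  fix A B C
  let ?s = "symb A B C"
  assume pos: "\<And>d i. i \<in> I \<Longrightarrow> i + d \<notin> I \<Longrightarrow> ?s (int d) i = 0"
    and neg: "\<And>d i. i < d \<or> i \<in> I \<and> i - d \<notin> I \<Longrightarrow> ?s (- int d) i = 0"
  have s1: "?s (int 2) x = A (int 2) * (of_nat x - of_nat n) * (of_nat x - of_nat (n - 1))" for x
    by (rule symb_two_zeros[OF pos pos]) (use I ml in auto)
  have s2: "?s (int 1) x = A (int 1) * (of_nat x - of_nat 0) * (of_nat x - of_nat n)" for x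
    by (rule symb_two_zeros[OF pos pos]) (use I ml in auto)
  have s3: "?s (int d) x = 0" if "3 \<le> d" for d x
    by (rule symb_eq_0[where r = "n - 2" and s = "n - 1" and t = n, OF pos pos pos]) (use I ml that in auto)
  have minus_ge_3: "?s (- int d) x = 0" if "3 \<le> d" for d x
    by (rule symb_eq_0[where r = 0 and s = 1 and t = 2, OF neg neg neg]) (use that in auto)
  have s4: "?s (- int 1) x = A (- int 1) * (of_nat x - of_nat 0) * (of_nat x - of_nat 2)" for x
    by (rule symb_two_zeros[OF neg neg]) (use I ml in auto)
  \<comment> \<open>The element 3 moves to the gap 1 and is a third zero.\<close>
  have s5: "?s (- int 2) x = 0" for x
    by (rule symb_eq_0[where r = 0 and s = 1 and t = 3, OF neg neg neg]) (use I ml in auto)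
  define \<alpha> :: "nat \<Rightarrow> complex" where "\<alpha> = (\<lambda>_. 0)(1 := A 2, 2 := A 1,
    3 := A 0, 4 := B 0, 5 := C 0, 6 := A (- 1))"
  have \<alpha>: "\<alpha> 1 = A 2" "\<alpha> 2 = A 1"
    "\<alpha> 3 = A 0" "\<alpha> 4 = B 0" "\<alpha> 5 = C 0" "\<alpha> 6 = A (- 1)"
    by (simp_all add: \<alpha>_def)
  have "coeff (T2_D n \<alpha> (monom 1 x)) j = ?s k x" if k: "int j - int x = k" for x j k
  proof -
    note T = T2_D_def of_nat_eqs coeff_add coeff_smult coeff_op_monom \<alpha>
      if_distrib[of "\<lambda>f. coeff f j"] coeff_0 k
    show ?thesis
    proof (cases k rule: int_shift_cases)
      case (1 d)
      consider "d = 0" | "d = 1" | "d = 2" | "3 \<le> d" by linarith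
      then show ?thesis
      proof cases
        case 4
        then show ?thesis unfolding T using ml 1 s3[of d x] by simp
      qed (unfold T, use ml 1 s1[of x] s2[of x] in \<open>simp_all add: symb_at_0\<close>)
    next
      case 2
      then show ?thesis unfolding T using ml s4[of x] by auto
    next
      case 3
      then show ?thesis unfolding T using ml s5[of x] by auto
    next
      case (4 d)
      then show ?thesis unfolding T using ml minus_ge_3[of d x] by auto
    qed
  qed
  then show "\<exists>\<alpha>. \<forall>x j. coeff (T2_D n \<alpha> (monom 1 x)) j = ?s (int j - int x) x" by blast
qed

theorem mainTheorem4:
  fixes I :: "nat set"
  assumes "finite I" and "0 \<in> I" and "Gcd I = 1"
    and "\<not> (\<exists>l::int. l > 0 \<and> card (shift_out I l) = 1)"
    and "\<exists>l1 l2 :: int. l1 \<noteq> l2 \<and> l1 > 0 \<and> l2 > 0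
           \<and> card (shift_out I l1) = 2 \<and> card (shift_out I l2) = 2"
  shows "((\<exists>m l. form_A I m l) \<or> (\<exists>m l. form_B I m l) \<or> (\<exists>n. form_C I n) \<or> (\<exists>n. form_D I n))
    \<and> (\<forall>m l. form_A I m l \<longrightarrow> preserving_ops 2 (monomial_span I) = range (T2_A m l))
    \<and> (\<forall>m l. form_B I m l \<longrightarrow> preserving_ops 2 (monomial_span I) = range (T2_B m l))
    \<and> (\<forall>n. form_C I n \<longrightarrow> preserving_ops 2 (monomial_span I) = range (T2_C n))
    \<and> (\<forall>n. form_D I n \<longrightarrow> preserving_ops 2 (monomial_span I) = range (T2_D n))"
proof -
  have no1: "card (shift_out I l) \<noteq> 1" if "0 < l" for l :: int
    using assms(4) that by blast
  obtain l1 l2 :: int where l: "l1 < l2" "0 < l1" "card (shift_out I l1) = 2" "card (shift_out I l2) = 2"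
    using assms(5) by (metis linorder_neqE)
  have "(\<exists>m l. form_A I m l) \<or> (\<exists>m l. form_B I m l) \<or> (\<exists>n. form_C I n) \<or> (\<exists>n. form_D I n)"
    by (rule classification[OF assms(1-3) no1, of "nat l1" "nat l2"]) (use l in auto)
  then show ?thesis
    using preserving_form_A preserving_form_B preserving_form_C preserving_form_D by blast
qed

end
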